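(* There is a universal constant $c>0$ such that for all integers $N\ge 2$, $t\ge 1$ and all $\delta\in(0,1)$, every quantum algorithm that solves the $(t,\delta)$-recurrence time problem for $N$-dimensional unitaries has cost at least $c\,t\sqrt{N}/\delta$ (i.e. cost $\Omega(t\sqrt N/\delta)$).
   Context: Model of computation. The input is an unknown $N$-dimensional unitary $U$. The state space is $\mathbb{C}^N\otimes W$, where the first register is $N$-dimensional with computational basis $|0\rangle,\dots,|N-1\rangle$ and $W$ is an arbitrarily large (finite-dimensional) workspace. The algorithm starts in $|0\rangle|0\rangle$; it may apply $U$ and $U^{-1}$ to the first register (possibly controlled by a qubit of the workspace), and arbitrary unitaries independent of $U$ to the whole space; at the end it performs a POVM (independent of $U$) which determines the classical output. The cost of the algorithm is the total number of applications of $U$ and $U^{-1}$ (including controlled versions); all other operations are free. The $(t,\delta)$-recurrence time problem (for integers $N\ge2$, $t\ge1$ and $\delta\in(0,1)$). Input promise: either $U=I$, or $\|U^t-I\|\ge\delta$ in spectral norm. Output: with probability at least $2/3$, output $1$ if $U=I$, and $0$ otherwise. An algorithm solves the problem if it meets this requirement for every $U$ satisfying the promise. *)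

theory Defs
  imports "Jordan_Normal_Form.Schur_Decomposition"
begin

section \<open>Linear algebra\<close>

definition unitary_mat :: "nat \<Rightarrow> complex mat \<Rightarrow> bool" where
  "unitary_mat n U \<longleftrightarrow>
     U \<in> carrier_mat n n \<and> mat_adjoint U * U = 1\<^sub>m n \<and> U * mat_adjoint U = 1\<^sub>m n"

definition psd_mat :: "nat \<Rightarrow> complex mat \<Rightarrow> bool" where
  "psd_mat n E \<longleftrightarrow>
     E \<in> carrier_mat n n \<and> mat_adjoint E = E \<and>
     (\<forall>v \<in> carrier_vec n. 0 \<le> Re ((E *\<^sub>v v) \<bullet>c v))"

definition l2_norm :: "complex vec \<Rightarrow> real" where
  "l2_norm v = sqrt (Re (v \<bullet>c v))"

definition spectral_norm :: "complex mat \<Rightarrow> real" where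
  "spectral_norm A = Sup {l2_norm (A *\<^sub>v v) | v. v \<in> carrier_vec (dim_col A) \<and> l2_norm v = 1}"

text \<open>The basis vector \<open>|x\<rangle>|w\<rangle>\<close> of a tensor product has index \<open>x * d + w\<close>,
  where \<open>d\<close> is the dimension of the second factor.\<close>

definition tensor_mat :: "complex mat \<Rightarrow> complex mat \<Rightarrow> complex mat" (infixl "\<otimes>\<^sub>m" 70) where
  "A \<otimes>\<^sub>m B = mat (dim_row A * dim_row B) (dim_col A * dim_col B)
     (\<lambda>(i, j). A $$ (i div dim_row B, j div dim_col B) * B $$ (i mod dim_row B, j mod dim_col B))"


section \<open>Query algorithms\<close>

text \<open>A circuit is a list of gates in order of application.  The argument of a controlled
  query is the number of the workspace qubit that controls it.\<close>

datatype gate =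
    Fixed "complex mat"
  | Query
  | Query_Inv
  | Controlled_Query nat
  | Controlled_Query_Inv nat

text \<open>The workspace consists of \<open>qubits\<close> qubits together with a register of arbitrary dimension
  \<open>extra_dim\<close>; its basis state with index \<open>w\<close> has the binary digits of \<open>w mod 2 ^ qubits\<close>
  in the qubits (qubit \<open>j\<close> holding the digit of weight \<open>2 ^ j\<close>) and \<open>w div 2 ^ qubits\<close>
  in the other register.  The POVM is the list of its elements, and observing its outcome \<open>i\<close>
  makes the algorithm output \<open>readout i\<close>.\<close>

record algorithm =
  qubits :: nat
  extra_dim :: nat
  circuit :: "gate list"
  povm :: "complex mat list"
  readout :: "nat \<Rightarrow> nat"

definition workspace_dim :: "algorithm \<Rightarrow> nat" where
  "workspace_dim A = 2 ^ qubits A * extra_dim A"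

definition valid_gate :: "nat \<Rightarrow> algorithm \<Rightarrow> gate \<Rightarrow> bool" where
  "valid_gate N A g \<longleftrightarrow>
     (case g of
        Fixed V \<Rightarrow> unitary_mat (N * workspace_dim A) V
      | Query \<Rightarrow> True
      | Query_Inv \<Rightarrow> True
      | Controlled_Query j \<Rightarrow> j < qubits A
      | Controlled_Query_Inv j \<Rightarrow> j < qubits A)"

definition is_povm :: "nat \<Rightarrow> complex mat list \<Rightarrow> bool" where
  "is_povm n Es \<longleftrightarrow> (\<forall>E \<in> set Es. psd_mat n E) \<and> foldr (+) Es (0\<^sub>m n n) = 1\<^sub>m n"

definition quantum_algorithm :: "nat \<Rightarrow> algorithm \<Rightarrow> bool" where
  "quantum_algorithm N A \<longleftrightarrow>
     extra_dim A \<ge> 1 \<and>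
     (\<forall>g \<in> set (circuit A). valid_gate N A g) \<and>
     is_povm (N * workspace_dim A) (povm A)"

text \<open>The projection, on a \<open>d\<close>-dimensional workspace, onto the states whose qubit \<open>j\<close>
  is \<open>|b\<rangle>\<close>.\<close>

definition qubit_proj :: "nat \<Rightarrow> nat \<Rightarrow> nat \<Rightarrow> complex mat" where
  "qubit_proj d j b = mat_diag d (\<lambda>w. if (w div 2 ^ j) mod 2 = b then 1 else 0)"

definition controlled :: "nat \<Rightarrow> nat \<Rightarrow> complex mat \<Rightarrow> complex mat" where
  "controlled d j U =
     1\<^sub>m (dim_row U) \<otimes>\<^sub>m qubit_proj d j 0 + U \<otimes>\<^sub>m qubit_proj d j 1"

text \<open>Inputs are unitary, so \<open>U\<^sup>-\<^sup>1\<close> is the adjoint.\<close>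

primrec gate_mat :: "nat \<Rightarrow> complex mat \<Rightarrow> gate \<Rightarrow> complex mat" where
  "gate_mat d U (Fixed V) = V"
| "gate_mat d U Query = U \<otimes>\<^sub>m 1\<^sub>m d"
| "gate_mat d U Query_Inv = mat_adjoint U \<otimes>\<^sub>m 1\<^sub>m d"
| "gate_mat d U (Controlled_Query j) = controlled d j U"
| "gate_mat d U (Controlled_Query_Inv j) = controlled d j (mat_adjoint U)"

text \<open>Index \<open>0\<close> is the initial state \<open>|0\<rangle>|0\<rangle>\<close>.\<close>

definition final_state :: "nat \<Rightarrow> algorithm \<Rightarrow> complex mat \<Rightarrow> complex vec" where
  "final_state N A U =
     fold (\<lambda>g v. gate_mat (workspace_dim A) U g *\<^sub>v v) (circuit A)
       (unit_vec (N * workspace_dim A) 0)"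

definition output_prob :: "nat \<Rightarrow> algorithm \<Rightarrow> complex mat \<Rightarrow> nat \<Rightarrow> real" where
  "output_prob N A U b =
     (\<Sum>i | i < length (povm A) \<and> readout A i = b.
        Re ((povm A ! i *\<^sub>v final_state N A U) \<bullet>c final_state N A U))"

primrec gate_cost :: "gate \<Rightarrow> nat" where
  "gate_cost (Fixed V) = 0"
| "gate_cost Query = 1"
| "gate_cost Query_Inv = 1"
| "gate_cost (Controlled_Query j) = 1"
| "gate_cost (Controlled_Query_Inv j) = 1"

definition cost :: "algorithm \<Rightarrow> nat" where
  "cost A = sum_list (map gate_cost (circuit A))"


section \<open>The recurrence time problem\<close>

definition solves_recurrence_time :: "nat \<Rightarrow> nat \<Rightarrow> real \<Rightarrow> algorithm \<Rightarrow> bool" where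
  "solves_recurrence_time N t \<delta> A \<longleftrightarrow>
     (\<forall>U. unitary_mat N U \<longrightarrow>
        (U = 1\<^sub>m N \<longrightarrow> output_prob N A U 1 \<ge> 2 / 3) \<and>
        (spectral_norm (U ^\<^sub>m t - 1\<^sub>m N) \<ge> \<delta> \<longrightarrow> output_prob N A U 0 \<ge> 2 / 3))"

end

theory Submission
  imports Defs "HOL-Analysis.L2_Norm"
begin

text \<open>Compare \<open>U = I\<close> with the \<open>N\<close> inputs \<open>I + (e\<^sup>i\<^sup>\<theta> - 1) |x\<rangle>\<langle>x|\<close> for \<open>\<theta> = 2 \<delta> / t\<close>, each of which
  satisfies the promise.  Replacing \<open>I\<close> by the \<open>x\<close>-th of them in one query moves the state by at
  most \<open>\<theta>\<close> times the amplitude it has on \<open>|x\<rangle>\<close>.  These amplitudes are square-summable to 1 over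
  \<open>x\<close>, so by Minkowski the \<open>\<ell>\<^sup>2\<close>-norm over \<open>x\<close> of the deviations from the run on \<open>I\<close> grows
  by at most \<open>\<theta>\<close> per query.  At the end each deviation is bounded below by a constant, so this
  norm is of order \<open>sqrt N\<close>.\<close>

section \<open>Norms and unitary matrices\<close>

text \<open>Links the norm defined by the scalar product to \<open>L2_set\<close>, so that
  monotonicity and Minkowski's inequality for \<open>L2_set\<close> apply to states as well as to
  families of norms.\<close>

lemma l2_norm_eq_L2_set: "l2_norm v = L2_set (\<lambda>i. cmod (v $ i)) {..<dim_vec v}"
proof -
  have "Re (v \<bullet>c v) = (\<Sum>i<dim_vec v. (cmod (v $ i))\<^sup>2)"
    by (simp add: scalar_prod_def atLeast0LessThan cmod_power2 flip: power2_eq_square)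
  then show ?thesis
    by (simp add: l2_norm_def L2_set_def)
qed

lemma l2_norm_square: "(l2_norm v)\<^sup>2 = Re (v \<bullet>c v)"
proof -
  have "0 \<le> Re (v \<bullet>c v)"
    by (simp add: scalar_prod_def sum_nonneg)
  then show ?thesis
    by (simp add: l2_norm_def)
qed

lemma l2_norm_nonneg: "0 \<le> l2_norm v"
  by (simp add: l2_norm_eq_L2_set)

lemma l2_norm_unit_vec: "i < n \<Longrightarrow> l2_norm (unit_vec n i) = 1"
  by (simp add: l2_norm_def)

lemma dim_mat_adjoint [simp]:
  "dim_row (mat_adjoint A) = dim_col A" "dim_col (mat_adjoint A) = dim_row A"
  by (simp_all add: mat_adjoint_def)

lemma index_mat_adjoint [simp]:
  fixes A :: "complex mat"
  assumes "i < dim_col A" "j < dim_row A"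
  shows "mat_adjoint A $$ (i, j) = cnj (A $$ (j, i))"
  using assms by (simp add: mat_adjoint_def mat_of_rows_index)

lemma cscalar_prod_mult_mat_vec:
  fixes A :: "complex mat"
  assumes A: "A \<in> carrier_mat n m" and v: "v \<in> carrier_vec m" and u: "u \<in> carrier_vec n"
  shows "(A *\<^sub>v v) \<bullet>c u = v \<bullet>c (mat_adjoint A *\<^sub>v u)"
proof -
  have "(A *\<^sub>v v) \<bullet>c u = (\<Sum>i<n. \<Sum>k<m. A $$ (i, k) * v $ k * cnj (u $ i))"
    using assms by (simp add: scalar_prod_def atLeast0LessThan sum_distrib_right)
  also have "\<dots> = (\<Sum>k<m. \<Sum>i<n. A $$ (i, k) * v $ k * cnj (u $ i))"
    by (rule sum.swap)
  also have "\<dots> = v \<bullet>c (mat_adjoint A *\<^sub>v u)"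
    using assms
    by (simp add: scalar_prod_def atLeast0LessThan sum_distrib_left mult_ac)
  finally show ?thesis .
qed

lemma l2_norm_unitary:
  assumes V: "unitary_mat n V" and v: "v \<in> carrier_vec n"
  shows "l2_norm (V *\<^sub>v v) = l2_norm v"
proof -
  have V': "V \<in> carrier_mat n n" "mat_adjoint V \<in> carrier_mat n n" "mat_adjoint V * V = 1\<^sub>m n"
    using V unfolding unitary_mat_def by auto
  have "(V *\<^sub>v v) \<bullet>c (V *\<^sub>v v) = v \<bullet>c (mat_adjoint V *\<^sub>v (V *\<^sub>v v))"
    using V' v by (intro cscalar_prod_mult_mat_vec) auto
  also have "mat_adjoint V *\<^sub>v (V *\<^sub>v v) = (mat_adjoint V * V) *\<^sub>v v"
    using V' v by (intro assoc_mult_mat_vec[symmetric]) auto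
  finally show ?thesis
    using V' v by (simp add: l2_norm_def)
qed


section \<open>Diagonal matrices\<close>

lemma mat_diag_cong: "(\<And>i. i < n \<Longrightarrow> f i = g i) \<Longrightarrow> mat_diag n f = mat_diag n g"
  by (auto simp: mat_diag_def)

lemma mat_diag_mult_vec:
  fixes v :: "'a :: comm_semiring_1 vec"
  assumes "v \<in> carrier_vec n"
  shows "mat_diag n f *\<^sub>v v = vec n (\<lambda>i. f i * v $ i)"
proof (rule eq_vecI)
  fix i assume "i < dim_vec (vec n (\<lambda>i. f i * v $ i))"
  then have i: "i < n" by simp
  then have "(mat_diag n f *\<^sub>v v) $ i = (\<Sum>j<n. (if i = j then f j else 0) * v $ j)"
    using assms by (simp add: mat_diag_def scalar_prod_def atLeast0LessThan)
  also have "\<dots> = (\<Sum>j<n. if i = j then f j * v $ j else 0)"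
    by (rule sum.cong) auto
  also have "\<dots> = f i * v $ i"
    using i by simp
  finally show "(mat_diag n f *\<^sub>v v) $ i = vec n (\<lambda>i. f i * v $ i) $ i"
    using i by simp
qed (simp add: mat_diag_def)

lemma mat_diag_add: "mat_diag n f + mat_diag n g = mat_diag n (\<lambda>i. f i + g i :: 'a :: monoid_add)"
  by (rule eq_matI) (auto simp: mat_diag_def)

lemma mat_adjoint_mat_diag: "mat_adjoint (mat_diag n f) = mat_diag n (\<lambda>i. cnj (f i))"
  by (rule eq_matI) (auto simp: mat_diag_def)

lemma mat_diag_pow:
  fixes f :: "nat \<Rightarrow> 'a :: semiring_1"
  shows "mat_diag n f ^\<^sub>m k = mat_diag n (\<lambda>i. f i ^ k)"
  \<comment> \<open>The zeroth power is the identity of size \<open>dim_row\<close>, so the base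
    case needs the dimension of \<open>mat_diag n f\<close>.\<close>
  by (induction k) (simp_all add: power_Suc2 mat_diag_def[of n f, THEN arg_cong[where f = dim_row]] del: power_Suc)

lemma tensor_mat_diag:
  "mat_diag n f \<otimes>\<^sub>m mat_diag d g = mat_diag (n * d) (\<lambda>i. f (i div d) * g (i mod d))"
proof (rule eq_matI)
  fix i j
  assume "i < dim_row (mat_diag (n * d) (\<lambda>i. f (i div d) * g (i mod d)))"
    and "j < dim_col (mat_diag (n * d) (\<lambda>i. f (i div d) * g (i mod d)))"
  then have ij: "i < n * d" "j < n * d"
    by (simp_all add: mat_diag_def)
  then have "0 < d" by (cases d) auto
  then have "i div d < n" "j div d < n" "i mod d < d" "j mod d < d"
    using ij by (simp_all add: less_mult_imp_div_less)
  \<comment> \<open>Off the diagonal, quotient or remainder differs, so one of the two factors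
    vanishes.\<close>
  moreover have "i = j \<longleftrightarrow> i div d = j div d \<and> i mod d = j mod d"
    by (metis div_mult_mod_eq)
  ultimately show "(mat_diag n f \<otimes>\<^sub>m mat_diag d g) $$ (i, j)
      = mat_diag (n * d) (\<lambda>i. f (i div d) * g (i mod d)) $$ (i, j)"
    using ij by (auto simp: tensor_mat_def mat_diag_def)
qed (simp_all add: tensor_mat_def mat_diag_def)

lemma unitary_mat_diag:
  assumes "\<And>i. i < n \<Longrightarrow> cmod (f i) = 1"
  shows "unitary_mat n (mat_diag n f)"
proof -
  have *: "mat_diag n (\<lambda>i. cnj (f i) * f i) = 1\<^sub>m n"
    using assms by (auto simp: mat_diag_def complex_norm_square[symmetric] mult.commute)
  then show ?thesis
    by (simp add: unitary_mat_def mat_adjoint_mat_diag mult.commute)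
qed

text \<open>The unit vector at \<open>x\<close> is scaled by \<open>f x\<close>, so
  \<open>cmod (f x)\<close> belongs to the set whose supremum is the spectral norm. A real
  \<open>Sup\<close> dominates the members of a set only if the set is bounded above; the crude
  bound \<open>?B\<close> serves for that.\<close>

lemma spectral_norm_mat_diag_ge:
  assumes x: "x < n"
  shows "cmod (f x) \<le> spectral_norm (mat_diag n f)"
proof -
  let ?S = "{l2_norm (mat_diag n f *\<^sub>v v) | v. v \<in> carrier_vec n \<and> l2_norm v = 1}"
  let ?B = "\<Sum>i<n. cmod (f i)"
  have "l2_norm (mat_diag n f *\<^sub>v v) \<le> ?B" if v: "v \<in> carrier_vec n" "l2_norm v = 1" for v
  proof -
    have "l2_norm (mat_diag n f *\<^sub>v v) = L2_set (\<lambda>i. cmod (f i) * cmod (v $ i)) {..<n}"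
      by (subst mat_diag_mult_vec[OF v(1)], subst l2_norm_eq_L2_set, rule L2_set_cong)
        (simp_all add: norm_mult)
    also have "\<dots> \<le> L2_set (\<lambda>i. ?B * cmod (v $ i)) {..<n}"
      by (intro L2_set_mono mult_right_mono member_le_sum) auto
    also have "\<dots> = ?B * l2_norm v"
      using v by (simp add: L2_set_right_distrib[symmetric] l2_norm_eq_L2_set sum_nonneg)
    finally show ?thesis using v by simp
  qed
  then have bdd: "bdd_above ?S"
    by (intro bdd_aboveI[of _ ?B]) auto
  have "mat_diag n f *\<^sub>v unit_vec n x = f x \<cdot>\<^sub>v unit_vec n x"
    by (subst mat_diag_mult_vec) (auto simp: unit_vec_def)
  then have "l2_norm (mat_diag n f *\<^sub>v unit_vec n x)
      = L2_set (\<lambda>i. cmod (f x) * cmod (unit_vec n x $ i)) {..<n}"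
    by (simp add: l2_norm_eq_L2_set norm_mult cong: L2_set_cong_simp)
  also have "\<dots> = cmod (f x) * l2_norm (unit_vec n x)"
    by (simp add: L2_set_right_distrib[symmetric] l2_norm_eq_L2_set)
  finally have "cmod (f x) = l2_norm (mat_diag n f *\<^sub>v unit_vec n x)"
    using x by (simp add: l2_norm_unit_vec)
  then have "cmod (f x) \<in> ?S"
    using x by (auto simp: l2_norm_unit_vec)
  then show ?thesis
    using bdd unfolding spectral_norm_def by (simp add: cSup_upper mat_diag_def)
qed


section \<open>Queries to a phase oracle\<close>

text \<open>On a diagonal input every query is diagonal on the whole space; these are its entries. A
  fixed gate makes no query, so its value is left open, and the lemmas below assume
  \<open>gate_cost g = 1\<close>, which singles out the four kinds of query.\<close>

primrec query_phase :: "nat \<Rightarrow> (nat \<Rightarrow> complex) \<Rightarrow> gate \<Rightarrow> nat \<Rightarrow> complex" where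
  "query_phase d f (Fixed V) i = undefined"
| "query_phase d f Query i = f (i div d)"
| "query_phase d f Query_Inv i = cnj (f (i div d))"
| "query_phase d f (Controlled_Query j) i =
     (if (i mod d div 2 ^ j) mod 2 = 0 then 1 else f (i div d))"
| "query_phase d f (Controlled_Query_Inv j) i =
     (if (i mod d div 2 ^ j) mod 2 = 0 then 1 else cnj (f (i div d)))"

lemma tensor_mat_diag_one:
  "mat_diag n f \<otimes>\<^sub>m 1\<^sub>m d = mat_diag (n * d) (\<lambda>i. f (i div d))"
  using tensor_mat_diag[of n f d "\<lambda>_. 1"] by simp

lemma controlled_mat_diag:
  "controlled d j (mat_diag n f) =
     mat_diag (n * d) (\<lambda>i. if (i mod d div 2 ^ j) mod 2 = 0 then 1 else f (i div d))"
proof -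
  have "dim_row (mat_diag n f) = n"
    by (simp add: mat_diag_def)
  then have "controlled d j (mat_diag n f)
      = mat_diag n (\<lambda>_. 1) \<otimes>\<^sub>m qubit_proj d j 0 + mat_diag n f \<otimes>\<^sub>m qubit_proj d j 1"
    by (simp add: controlled_def)
  also have "\<dots> = mat_diag (n * d) (\<lambda>i. if (i mod d div 2 ^ j) mod 2 = 0 then 1 else f (i div d))"
    unfolding qubit_proj_def tensor_mat_diag mat_diag_add by (rule mat_diag_cong) auto
  finally show ?thesis .
qed

lemma gate_mat_phase:
  assumes "gate_cost g = 1"
  shows "gate_mat d (mat_diag n f) g = mat_diag (n * d) (query_phase d f g)"
  using assms
  by (cases g) (auto simp: mat_adjoint_mat_diag tensor_mat_diag_one controlled_mat_diag intro!: mat_diag_cong)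

lemma gate_mat_query_one:
  assumes "gate_cost g = 1"
  shows "gate_mat d (1\<^sub>m n) g = 1\<^sub>m (n * d)"
proof -
  have "query_phase d (\<lambda>_. 1) g = (\<lambda>_. 1)"
    using assms by (cases g) auto
  then show ?thesis
    using gate_mat_phase[OF assms, of d n "\<lambda>_. 1"] by simp
qed

section \<open>Phase oracles and the hybrid argument\<close>

definition phase_oracle :: "nat \<Rightarrow> complex \<Rightarrow> nat \<Rightarrow> complex mat" where
  "phase_oracle n z x = mat_diag n (\<lambda>i. if i = x then z else 1)"

text \<open>The norm of the projection of \<open>w\<close> onto the states whose first register is
  \<open>x\<close>, that is, the amplitude that a query can detect at \<open>x\<close>.\<close>

definition block_norm :: "nat \<Rightarrow> nat \<Rightarrow> complex vec \<Rightarrow> real" where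
  "block_norm d x w = L2_set (\<lambda>i. if i div d = x then cmod (w $ i) else 0) {..<dim_vec w}"

text \<open>Pythagoras: each index \<open>i\<close> lies in exactly one block, the one with number
  \<open>i div d\<close>.\<close>

lemma L2_set_block_norm:
  assumes w: "w \<in> carrier_vec (n * d)"
  shows "L2_set (\<lambda>x. block_norm d x w) {..<n} = l2_norm w"
proof -
  have "(\<Sum>x<n. (block_norm d x w)\<^sup>2) = (\<Sum>x<n. \<Sum>i<n * d. if x = i div d then (cmod (w $ i))\<^sup>2 else 0)"
    using w by (simp add: block_norm_def L2_set_def sum_nonneg)
      (auto intro!: sum.cong)
  also have "\<dots> = (\<Sum>i<n * d. \<Sum>x<n. if x = i div d then (cmod (w $ i))\<^sup>2 else 0)"
    by (rule sum.swap)
  also have "\<dots> = (\<Sum>i<n * d. (cmod (w $ i))\<^sup>2)"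
    by (intro sum.cong refl) (simp add: less_mult_imp_div_less)
  finally show ?thesis
    using w by (simp add: l2_norm_eq_L2_set L2_set_def)
qed

text \<open>The new error is charged to the block of \<open>w\<close>, the state of the run on the
  identity, and not to that of \<open>v\<close>. Since \<open>w\<close> is the same for all
  \<open>x\<close>, its block norms can later be combined over \<open>x\<close>.\<close>

lemma phase_query_deviation:
  assumes g: "gate_cost g = 1" and z: "cmod z = 1"
    and v: "v \<in> carrier_vec (n * d)" and w: "w \<in> carrier_vec (n * d)"
  shows "l2_norm (gate_mat d (phase_oracle n z x) g *\<^sub>v v - gate_mat d (1\<^sub>m n) g *\<^sub>v w)
    \<le> l2_norm (v - w) + cmod (z - 1) * block_norm d x w"
proof -
  define c where "c = query_phase d (\<lambda>i. if i = x then z else 1) g"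
  have cnj_diff: "cmod (cnj z - 1) = cmod (z - 1)"
    by (metis complex_cnj_diff complex_cnj_one complex_mod_cnj)
  \<comment> \<open>All entries are phases, and they differ from 1 at most in block
    \<open>x\<close>; there a controlled query also has entry 1 where the control digit is
    0.\<close>
  have c: "cmod (c i) = 1" "cmod (c i - 1) \<le> (if i div d = x then cmod (z - 1) else 0)" for i
    using g z by (cases g; simp add: c_def cnj_diff)+
  have "cmod (c i * v $ i - w $ i)
      \<le> cmod ((v - w) $ i) + cmod (z - 1) * (if i div d = x then cmod (w $ i) else 0)"
    if i: "i < n * d" for i
  proof -
    \<comment> \<open>The first term carries the old deviation along without changing its modulus;
      the second is the error made by this query.\<close>
    have "c i * v $ i - w $ i = c i * (v - w) $ i + (c i - 1) * w $ i"
      using i v w by (simp add: algebra_simps)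
    then have "cmod (c i * v $ i - w $ i) \<le> cmod (c i * (v - w) $ i) + cmod ((c i - 1) * w $ i)"
      by (metis norm_triangle_ineq)
    also have "\<dots> \<le> cmod ((v - w) $ i) + (if i div d = x then cmod (z - 1) else 0) * cmod (w $ i)"
      using mult_right_mono[OF c(2)[of i], of "cmod (w $ i)"] by (simp add: norm_mult c)
    finally show ?thesis by (simp split: if_splits)
  qed
  then have "L2_set (\<lambda>i. cmod (c i * v $ i - w $ i)) {..<n * d}
    \<le> L2_set (\<lambda>i. cmod ((v - w) $ i) + cmod (z - 1) * (if i div d = x then cmod (w $ i) else 0)) {..<n * d}"
    by (intro L2_set_mono) auto
  also have "\<dots> \<le> L2_set (\<lambda>i. cmod ((v - w) $ i)) {..<n * d}
      + L2_set (\<lambda>i. cmod (z - 1) * (if i div d = x then cmod (w $ i) else 0)) {..<n * d}"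
    by (rule L2_set_triangle_ineq)
  also have "\<dots> = l2_norm (v - w) + cmod (z - 1) * block_norm d x w"
    using w by (simp add: l2_norm_eq_L2_set block_norm_def L2_set_right_distrib)
  finally have "L2_set (\<lambda>i. cmod (c i * v $ i - w $ i)) {..<n * d}
    \<le> l2_norm (v - w) + cmod (z - 1) * block_norm d x w" .
  moreover have "gate_mat d (phase_oracle n z x) g *\<^sub>v v - gate_mat d (1\<^sub>m n) g *\<^sub>v w
      = vec (n * d) (\<lambda>i. c i * v $ i - w $ i)"
    using w unfolding phase_oracle_def gate_mat_phase[OF g] gate_mat_query_one[OF g]
      mat_diag_mult_vec[OF v] c_def by auto
  ultimately show ?thesis
    by (simp add: l2_norm_eq_L2_set cong: L2_set_cong_simp)
qed

text \<open>Induction along the circuit, with arbitrary start states so that the hypothesis applies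
  after the first gate. A fixed gate is an isometry and keeps every deviation; a query adds at most
  \<open>\<eta>\<close> times the norm of the reference state, which no gate changes.\<close>

lemma hybrid_bound:
  assumes z: "cmod z = 1" "cmod (z - 1) \<le> \<eta>"
    and gs: "\<forall>g \<in> set gs. valid_gate n A g" and d: "d = workspace_dim A"
    and v: "\<And>x. v x \<in> carrier_vec (n * d)" and w: "w \<in> carrier_vec (n * d)"
  shows "L2_set (\<lambda>x. l2_norm (fold (\<lambda>g v. gate_mat d (phase_oracle n z x) g *\<^sub>v v) gs (v x)
             - fold (\<lambda>g v. gate_mat d (1\<^sub>m n) g *\<^sub>v v) gs w)) {..<n}
    \<le> L2_set (\<lambda>x. l2_norm (v x - w)) {..<n} + \<eta> * real (sum_list (map gate_cost gs)) * l2_norm w"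
  using gs v w
proof (induction gs arbitrary: v w)
  case Nil
  then show ?case by simp
next
  case (Cons g gs)
  let ?v = "\<lambda>x. gate_mat d (phase_oracle n z x) g *\<^sub>v v x" and ?w = "gate_mat d (1\<^sub>m n) g *\<^sub>v w"
  have step: "(\<forall>x. ?v x \<in> carrier_vec (n * d)) \<and> ?w \<in> carrier_vec (n * d) \<and> l2_norm ?w = l2_norm w \<and>
    L2_set (\<lambda>x. l2_norm (?v x - ?w)) {..<n}
      \<le> L2_set (\<lambda>x. l2_norm (v x - w)) {..<n} + \<eta> * real (gate_cost g) * l2_norm w"
  proof (cases "\<exists>V. g = Fixed V")
    case True
    then obtain V where g: "g = Fixed V" by blast
    then have V: "unitary_mat (n * d) V"
      using Cons.prems(1) by (simp add: valid_gate_def d)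
    then have V': "V \<in> carrier_mat (n * d) (n * d)"
      by (simp add: unitary_mat_def)
    have "V *\<^sub>v v x - V *\<^sub>v w = V *\<^sub>v (v x - w)" for x
      using V' Cons.prems(2)[of x] Cons.prems(3) by (simp add: mult_minus_distrib_mat_vec)
    then show ?thesis
      using g V V' Cons.prems(2,3) by (auto simp: l2_norm_unitary)
  next
    case False
    then have g: "gate_cost g = 1" by (cases g) auto
    \<comment> \<open>A query to the identity does nothing, so the reference state stays
      put.\<close>
    have w: "?w = w"
      using Cons.prems(3) by (simp add: gate_mat_query_one[OF g])
    have "?v x \<in> carrier_vec (n * d)" for x
      using Cons.prems(2)[of x] by (simp add: phase_oracle_def gate_mat_phase[OF g] mat_diag_mult_vec)
    moreover have "L2_set (\<lambda>x. l2_norm (?v x - ?w)) {..<n}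
      \<le> L2_set (\<lambda>x. l2_norm (v x - w) + \<eta> * block_norm d x w) {..<n}"
    proof (rule L2_set_mono)
      fix x
      have "l2_norm (?v x - ?w) \<le> l2_norm (v x - w) + cmod (z - 1) * block_norm d x w"
        using g z(1) Cons.prems(2,3) by (rule phase_query_deviation)
      also have "\<dots> \<le> l2_norm (v x - w) + \<eta> * block_norm d x w"
        using z(2) by (simp add: mult_right_mono block_norm_def)
      finally show "l2_norm (?v x - ?w) \<le> l2_norm (v x - w) + \<eta> * block_norm d x w" .
    qed (simp add: l2_norm_nonneg)
    \<comment> \<open>Minkowski over \<open>x\<close>. The block norms of the single vector
      \<open>w\<close> combine to \<open>l2_norm w\<close>, so the last term is
      \<open>\<eta> * l2_norm w\<close> with no factor growing with \<open>n\<close>.\<close>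
    moreover have "\<dots> \<le> L2_set (\<lambda>x. l2_norm (v x - w)) {..<n} + L2_set (\<lambda>x. \<eta> * block_norm d x w) {..<n}"
      by (rule L2_set_triangle_ineq)
    moreover have "0 \<le> \<eta>"
      using z(2) norm_ge_zero order_trans by blast
    ultimately show ?thesis
      using g w Cons.prems(3)
      by (simp add: L2_set_right_distrib[symmetric] L2_set_block_norm)
  qed
  have "L2_set (\<lambda>x. l2_norm (fold (\<lambda>g v. gate_mat d (phase_oracle n z x) g *\<^sub>v v) gs (?v x)
             - fold (\<lambda>g v. gate_mat d (1\<^sub>m n) g *\<^sub>v v) gs ?w)) {..<n}
    \<le> L2_set (\<lambda>x. l2_norm (?v x - ?w)) {..<n} + \<eta> * real (sum_list (map gate_cost gs)) * l2_norm ?w"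
    using Cons.prems(1) step by (intro Cons.IH) auto
  then show ?case
    using step by (simp add: algebra_simps)
qed

section \<open>Normalization of the final states\<close>

lemma unitary_gate_mat:
  assumes g: "valid_gate n A g" and d: "d = workspace_dim A"
    and f: "\<And>i. i < n \<Longrightarrow> cmod (f i) = 1"
  shows "unitary_mat (n * d) (gate_mat d (mat_diag n f) g)"
proof (cases "\<exists>V. g = Fixed V")
  case True
  then show ?thesis
    using g by (auto simp: valid_gate_def d)
next
  case False
  then have g: "gate_cost g = 1" by (cases g) auto
  have "cmod (query_phase d f g i) = 1" if "i < n * d" for i
    using g f[of "i div d"] that by (cases g) (auto simp: less_mult_imp_div_less)
  then show ?thesis
    unfolding gate_mat_phase[OF g] by (rule unitary_mat_diag)
qed

text \<open>Stated for all diagonal unitaries in order to cover both the phase oracles and the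
  identity, which is the case of constant entry 1.\<close>

lemma final_state_phase:
  assumes A: "quantum_algorithm n A" and f: "\<And>i. i < n \<Longrightarrow> cmod (f i) = 1" and n: "0 < n"
  shows "final_state n A (mat_diag n f) \<in> carrier_vec (n * workspace_dim A)"
    and "l2_norm (final_state n A (mat_diag n f)) = 1"
proof -
  define d where "d = workspace_dim A"
  have fold: "fold (\<lambda>g v. gate_mat d (mat_diag n f) g *\<^sub>v v) gs v \<in> carrier_vec (n * d) \<and>
      l2_norm (fold (\<lambda>g v. gate_mat d (mat_diag n f) g *\<^sub>v v) gs v) = l2_norm v"
    if "\<forall>g \<in> set gs. valid_gate n A g" "v \<in> carrier_vec (n * d)" for gs v
    using that
  proof (induction gs arbitrary: v)
    case (Cons g gs)
    then have V: "unitary_mat (n * d) (gate_mat d (mat_diag n f) g)"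
      by (intro unitary_gate_mat[OF _ d_def f]) auto
    then have "gate_mat d (mat_diag n f) g *\<^sub>v v \<in> carrier_vec (n * d)"
      using Cons.prems(2) by (auto simp: unitary_mat_def)
    then show ?case
      using Cons.IH[of "gate_mat d (mat_diag n f) g *\<^sub>v v"] Cons.prems l2_norm_unitary[OF V] by auto
  qed simp
  \<comment> \<open>The space must be nonzero for index 0 to name a unit vector.\<close>
  have "0 < d"
    using A by (simp add: d_def workspace_dim_def quantum_algorithm_def)
  then have "0 < n * d"
    using n by simp
  then show "final_state n A (mat_diag n f) \<in> carrier_vec (n * workspace_dim A)"
      "l2_norm (final_state n A (mat_diag n f)) = 1"
    using fold[of "circuit A" "unit_vec (n * d) 0"] A
    by (auto simp: final_state_def d_def quantum_algorithm_def l2_norm_unit_vec)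
qed


section \<open>Measurement\<close>

text \<open>The dimension claim is part of the induction because distributing a matrix sum over a
  vector requires it.\<close>

lemma foldr_add_mat:
  assumes "\<forall>E \<in> set Es. E \<in> carrier_mat n n" and v: "v \<in> carrier_vec n"
  shows "foldr (+) Es (0\<^sub>m n n) \<in> carrier_mat n n \<and>
    (foldr (+) Es (0\<^sub>m n n) *\<^sub>v v) \<bullet>c v = sum_list (map (\<lambda>E. (E *\<^sub>v v) \<bullet>c v) Es)"
  using assms(1)
proof (induction Es)
  case Nil
  then show ?case using v by (simp add: scalar_prod_def)
next
  case (Cons E Es)
  then have F: "foldr (+) Es (0\<^sub>m n n) \<in> carrier_mat n n" and E: "E \<in> carrier_mat n n"
    by auto
  have "((E + foldr (+) Es (0\<^sub>m n n)) *\<^sub>v v) \<bullet>c v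
      = (E *\<^sub>v v) \<bullet>c v + (foldr (+) Es (0\<^sub>m n n) *\<^sub>v v) \<bullet>c v"
    unfolding add_mult_distrib_mat_vec[OF E F v]
    using E F v by (intro add_scalar_prod_distrib[of _ n]) auto
  then show ?case
    using Cons E F by simp
qed

lemma povm_sum:
  assumes Es: "is_povm n Es" and v: "v \<in> carrier_vec n"
  shows "(\<Sum>i<length Es. Re ((Es ! i *\<^sub>v v) \<bullet>c v)) = (l2_norm v)\<^sup>2"
proof -
  have "sum_list (map (\<lambda>E. (E *\<^sub>v v) \<bullet>c v) Es) = v \<bullet>c v"
    using foldr_add_mat[of Es n v] Es v by (simp add: is_povm_def psd_mat_def)
  then have "(\<Sum>i<length Es. (Es ! i *\<^sub>v v) \<bullet>c v) = v \<bullet>c v"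
    by (simp add: sum_list_sum_nth atLeast0LessThan)
  then show ?thesis
    by (simp add: l2_norm_square flip: Re_sum)
qed

lemma povm_sum_le:
  assumes Es: "is_povm n Es" and v: "v \<in> carrier_vec n" and S: "S \<subseteq> {..<length Es}"
  shows "(\<Sum>i\<in>S. Re ((Es ! i *\<^sub>v v) \<bullet>c v)) \<le> (l2_norm v)\<^sup>2"
  unfolding povm_sum[OF Es v, symmetric]
  using assms by (intro sum_mono2) (auto simp: is_povm_def psd_mat_def)

lemma quadratic_form_add_smult:
  fixes E :: "complex mat"
  assumes E: "E \<in> carrier_mat n n" and u: "u \<in> carrier_vec n" and w: "w \<in> carrier_vec n"
  shows "(E *\<^sub>v (u + complex_of_real c \<cdot>\<^sub>v w)) \<bullet>c (u + complex_of_real c \<cdot>\<^sub>v w)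
    = (E *\<^sub>v u) \<bullet>c u + c * ((E *\<^sub>v u) \<bullet>c w + (E *\<^sub>v w) \<bullet>c u) + c\<^sup>2 * ((E *\<^sub>v w) \<bullet>c w)"
proof -
  have Ew: "E *\<^sub>v (u + complex_of_real c \<cdot>\<^sub>v w) = E *\<^sub>v u + complex_of_real c \<cdot>\<^sub>v (E *\<^sub>v w)"
    using assms by (simp add: mult_add_distrib_mat_vec mult_mat_vec)
  show ?thesis
    unfolding Ew using E u w
    \<comment> \<open>Products of \<open>E\<close> with a vector must stay unexpanded, so that both
      sides become sums over one index in the same entries.\<close>
    by (simp add: scalar_prod_def sum.distrib sum_distrib_left algebra_simps power2_eq_square
        del: index_mult_mat_vec)
qed

text \<open>Positivity at \<open>u - 2 (v - u)\<close> bounds the cross terms in the expansion of the form at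
  \<open>v = u + (v - u)\<close>.\<close>

lemma psd_form_le:
  assumes E: "psd_mat n E" and u: "u \<in> carrier_vec n" and v: "v \<in> carrier_vec n"
  shows "Re ((E *\<^sub>v v) \<bullet>c v)
    \<le> 3 / 2 * Re ((E *\<^sub>v u) \<bullet>c u) + 3 * Re ((E *\<^sub>v (v - u)) \<bullet>c (v - u))"
proof -
  have E': "E \<in> carrier_mat n n"
    using E by (simp add: psd_mat_def)
  define w where "w = v - u"
  have w: "w \<in> carrier_vec n"
    using u v by (simp add: w_def)
  have v_eq: "v = u + complex_of_real 1 \<cdot>\<^sub>v w"
    using u v by (auto simp: w_def)
  define a b c where "a = Re ((E *\<^sub>v u) \<bullet>c u)" "b = Re ((E *\<^sub>v u) \<bullet>c w + (E *\<^sub>v w) \<bullet>c u)"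
    "c = Re ((E *\<^sub>v w) \<bullet>c w)"
  have form: "Re ((E *\<^sub>v (u + complex_of_real s \<cdot>\<^sub>v w)) \<bullet>c (u + complex_of_real s \<cdot>\<^sub>v w)) = a + s * b + s\<^sup>2 * c"
    for s
    unfolding quadratic_form_add_smult[OF E' u w] a_b_c_def
    by (simp flip: of_real_power)
  have "0 \<le> a + (-2) * b + (-2)\<^sup>2 * c"
    unfolding form[symmetric] using E u w by (simp add: psd_mat_def)
  moreover have "Re ((E *\<^sub>v v) \<bullet>c v) = a + b + c"
    using form[of 1] unfolding v_eq[symmetric] by simp
  ultimately show ?thesis
    unfolding w_def[symmetric] a_b_c_def[symmetric] by simp
qed

text \<open>Let u and v be the final states on \<open>U\<close> and \<open>V\<close>. Output 1 has
  probability at most 1/3 on u and at least 2/3 on v. Summing \<open>psd_form_le\<close> over the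
  outcomes read as 1 gives 2/3 \<le> 3/2 * 1/3 + 3 e, where e is the squared distance of u and v;
  hence e \<ge> 1/18.\<close>

lemma output_prob_deviation:
  assumes A: "quantum_algorithm n A"
    and u: "final_state n A U \<in> carrier_vec (n * workspace_dim A)" "l2_norm (final_state n A U) = 1"
    and v: "final_state n A V \<in> carrier_vec (n * workspace_dim A)"
    and p0: "2 / 3 \<le> output_prob n A U 0" and p1: "2 / 3 \<le> output_prob n A V 1"
  shows "sqrt (1 / 18) \<le> l2_norm (final_state n A U - final_state n A V)"
proof -
  define m where "m = n * workspace_dim A"
  define S where "S b = {i. i < length (povm A) \<and> readout A i = b}" for b
  define q where "q w i = Re ((povm A ! i *\<^sub>v w) \<bullet>c w)" for w i
  let ?u = "final_state n A U" and ?v = "final_state n A V"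
  have P: "is_povm m (povm A)"
    using A by (simp add: quantum_algorithm_def m_def)
  have prob: "output_prob n A W b = sum (q (final_state n A W)) (S b)" for W b
    by (simp add: output_prob_def S_def q_def)
  have uv: "?u \<in> carrier_vec m" "?v \<in> carrier_vec m" "?v - ?u \<in> carrier_vec m"
    using u v by (auto simp: m_def)
  have "sum (q ?u) (S 0) + sum (q ?u) (S 1) = sum (q ?u) (S 0 \<union> S 1)"
    by (rule sum.union_disjoint[symmetric]) (auto simp: S_def)
  \<comment> \<open>Only an inequality, since outcomes may be read as numbers other than 0 and
    1.\<close>
  also have "\<dots> \<le> 1"
    using povm_sum_le[OF P uv(1), of "S 0 \<union> S 1"] u by (auto simp: S_def q_def)
  finally have u1: "sum (q ?u) (S 1) \<le> 1 / 3"
    using p0 by (simp add: prob)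
  have "2 / 3 \<le> sum (q ?v) (S 1)"
    using p1 by (simp add: prob)
  also have "\<dots> \<le> (\<Sum>i\<in>S 1. 3 / 2 * q ?u i + 3 * q (?v - ?u) i)"
  proof (rule sum_mono)
    fix i assume "i \<in> S 1"
    then have "psd_mat m (povm A ! i)"
      using P by (simp add: is_povm_def S_def)
    then show "q ?v i \<le> 3 / 2 * q ?u i + 3 * q (?v - ?u) i"
      unfolding q_def using uv(1,2) by (rule psd_form_le)
  qed
  also have "\<dots> = 3 / 2 * sum (q ?u) (S 1) + 3 * sum (q (?v - ?u)) (S 1)"
    by (simp add: sum.distrib sum_distrib_left)
  \<comment> \<open>The difference is not normalized, so its total over all outcomes is its squared
    norm.\<close>
  also have "sum (q (?v - ?u)) (S 1) \<le> (l2_norm (?v - ?u))\<^sup>2"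
    using povm_sum_le[OF P uv(3), of "S 1"] by (auto simp: S_def q_def)
  also have "l2_norm (?v - ?u) = l2_norm (?u - ?v)"
    using uv by (simp add: l2_norm_eq_L2_set norm_minus_commute cong: L2_set_cong_simp)
  finally have "1 / 18 \<le> (l2_norm (?u - ?v))\<^sup>2"
    using u1 by simp
  then show ?thesis
    by (rule real_le_lsqrt[OF l2_norm_nonneg])
qed


section \<open>The lower bound\<close>

text \<open>The length of the chord of the unit circle subtending the angle
  \<open>a\<close>.\<close>

lemma cmod_cis_minus_one: "cmod (cis a - 1) = 2 * \<bar>sin (a / 2)\<bar>"
proof -
  have "(cmod (cis a - 1))\<^sup>2 = (cos a)\<^sup>2 + (sin a)\<^sup>2 - 2 * cos a + 1"
    by (simp add: cmod_power2 power2_diff)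
  also have "\<dots> = 2 - 2 * cos a"
    by simp
  also have "\<dots> = (2 * \<bar>sin (a / 2)\<bar>)\<^sup>2"
    using cos_double_sin[of "a / 2"] by (simp add: power_mult_distrib)
  finally show ?thesis
    by (rule power2_eq_imp_eq) simp_all
qed

text \<open>By the mean value theorem, as the derivative \<open>cos\<close> is at least 1/2 on
  [0, 1]. This is the estimate that makes the chord of angle 2 \<delta> at least \<delta>.\<close>

lemma sin_ge_half:
  fixes x :: real
  assumes "0 \<le> x" "x \<le> 1"
  shows "x / 2 \<le> sin x"
proof (cases "x = 0")
  case False
  then have "0 < x" using assms by simp
  then obtain y where y: "0 < y" "y < x" "sin x - sin 0 = (x - 0) * cos y"
    using MVT2[of 0 x sin cos] DERIV_sin by blast
  have "(sin (y / 2))\<^sup>2 \<le> (y / 2)\<^sup>2"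
    using abs_sin_x_le_abs_x[of "y / 2"] by (simp only: abs_le_square_iff)
  also have "\<dots> \<le> (1 / 2)\<^sup>2"
    using y assms by (intro power_mono) auto
  \<comment> \<open>From cos y = 1 - 2 sin(y/2)^2 and sin(y/2)^2 \<le> 1/4.\<close>
  finally have "1 / 2 \<le> cos y"
    using cos_double_sin[of "y / 2"] by (simp add: power2_eq_square)
  then have "x * (1 / 2) \<le> x * cos y"
    using assms by (intro mult_left_mono)
  then show ?thesis using y by simp
qed simp

text \<open>The \<open>t\<close>-th power turns the phase at \<open>x\<close> into
  \<open>cis (2 * \<delta>)\<close>, at distance 2 sin \<delta> \<ge> \<delta> from 1. So each
  oracle satisfies the promise.\<close>

lemma spectral_norm_phase_oracle_pow:
  assumes "x < n" "0 < t" "0 < \<delta>" "\<delta> < 1"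
  shows "\<delta> \<le> spectral_norm (phase_oracle n (cis (2 * \<delta> / real t)) x ^\<^sub>m t - 1\<^sub>m n)"
proof -
  define z where "z = cis (2 * \<delta> / real t)"
  have "phase_oracle n z x ^\<^sub>m t - 1\<^sub>m n = mat_diag n (\<lambda>i. (if i = x then z else 1) ^ t - 1)"
    unfolding phase_oracle_def mat_diag_pow by (rule eq_matI) (auto simp: mat_diag_def)
  then have "cmod (z ^ t - 1) \<le> spectral_norm (phase_oracle n z x ^\<^sub>m t - 1\<^sub>m n)"
    using spectral_norm_mat_diag_ge[OF assms(1), of "\<lambda>i. (if i = x then z else 1) ^ t - 1"] by simp
  moreover have "z ^ t = cis (2 * \<delta>)"
    using assms by (simp add: z_def DeMoivre)
  ultimately show ?thesis
    using sin_ge_half[of \<delta>] assms by (simp add: z_def cmod_cis_minus_one)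
qed

theorem theorem1p1:
  shows "\<exists>c::real. c > 0 \<and>
    (\<forall>(N::nat) (t::nat) (\<delta>::real) (A::algorithm).
       N \<ge> 2 \<longrightarrow> t \<ge> 1 \<longrightarrow> 0 < \<delta> \<longrightarrow> \<delta> < 1 \<longrightarrow>
       quantum_algorithm N A \<longrightarrow> solves_recurrence_time N t \<delta> A \<longrightarrow>
       real (cost A) \<ge> c * real t * sqrt (real N) / \<delta>)"
\<comment> \<open>The constant is 1/5, a lower bound for \<open>sqrt (1 / 18)\<close>, divided by
  the 2 in the phase angle \<open>2 * \<delta> / real t\<close>.\<close>
proof (intro exI[of _ "1 / 10"] conjI allI impI)
  fix N t :: nat and \<delta> :: real and A :: algorithm
  assume N: "N \<ge> 2" and t: "t \<ge> 1" and \<delta>: "0 < \<delta>" "\<delta> < 1"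
    and A: "quantum_algorithm N A" and sol: "solves_recurrence_time N t \<delta> A"
  define d where "d = workspace_dim A"
  define z where "z = cis (2 * \<delta> / real t)"
  define U where "U = phase_oracle N z"
  \<comment> \<open>The chord is at most the arc: 2 |sin (\<delta>/t)| \<le> 2 \<delta>/t.\<close>
  have z: "cmod z = 1" "cmod (z - 1) \<le> 2 * \<delta> / real t"
    using abs_sin_x_le_abs_x[of "\<delta> / real t"] t \<delta> by (simp_all add: z_def cmod_cis_minus_one)
  have U: "unitary_mat N (U x)" "final_state N A (U x) \<in> carrier_vec (N * d)"
      "l2_norm (final_state N A (U x)) = 1" for x
    unfolding U_def phase_oracle_def d_def
    using z N A by (auto intro!: unitary_mat_diag final_state_phase)
  have I: "unitary_mat N (1\<^sub>m N)" "final_state N A (1\<^sub>m N) \<in> carrier_vec (N * d)"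
    using unitary_mat_diag[of N "\<lambda>_. 1"] final_state_phase[OF A, of "\<lambda>_. 1"] N
    by (simp_all add: d_def)
  have dev: "sqrt (1 / 18) \<le> l2_norm (final_state N A (U x) - final_state N A (1\<^sub>m N))" if "x < N" for x
  proof (rule output_prob_deviation)
    show "2 / 3 \<le> output_prob N A (U x) 0" "2 / 3 \<le> output_prob N A (1\<^sub>m N) 1"
      using sol U(1)[of x] I(1) spectral_norm_phase_oracle_pow[of x N t \<delta>] that t \<delta>
      by (auto simp: solves_recurrence_time_def U_def z_def)
  qed (use A U I in \<open>simp_all add: d_def\<close>)
  \<comment> \<open>Every one of the \<open>N\<close> deviations is at least
    \<open>sqrt (1 / 18)\<close>, which yields the factor \<open>sqrt (real N)\<close> in the
    combined norm.\<close>
  have "sqrt (real N) * sqrt (1 / 18) = L2_set (\<lambda>x. sqrt (1 / 18)) {..<N}"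
    by (simp add: L2_set_constant)
  also have "\<dots> \<le> L2_set (\<lambda>x. l2_norm (final_state N A (U x) - final_state N A (1\<^sub>m N))) {..<N}"
    using dev by (intro L2_set_mono) auto
  also have "\<dots> \<le> L2_set (\<lambda>x. l2_norm (unit_vec (N * d) 0 - unit_vec (N * d) 0)) {..<N}
      + 2 * \<delta> / real t * real (sum_list (map gate_cost (circuit A))) * l2_norm (unit_vec (N * d) 0)"
    unfolding final_state_def d_def[symmetric] U_def
    using A z by (intro hybrid_bound[OF _ _ _ d_def]) (auto simp: quantum_algorithm_def)
  \<comment> \<open>All runs start in the same unit vector, so the initial deviations
    vanish.\<close>
  also have "\<dots> = 2 * \<delta> / real t * real (cost A)"
  proof -
    have "0 < N * d"
      using A N by (simp add: d_def workspace_dim_def quantum_algorithm_def)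
    then show ?thesis
      by (simp add: l2_norm_unit_vec cost_def l2_norm_eq_L2_set[of "_ - _"] L2_set_def)
  qed
  finally have *: "sqrt (real N) * sqrt (1 / 18) \<le> 2 * \<delta> / real t * real (cost A)" .
  have "1 / 5 \<le> sqrt (1 / 18)"
    by (rule real_le_rsqrt) (simp add: power2_eq_square)
  then have "sqrt (real N) * (1 / 5) \<le> 2 * \<delta> / real t * real (cost A)"
    using * mult_left_mono[of "1 / 5" "sqrt (1 / 18)" "sqrt (real N)"] by simp
  then show "1 / 10 * real t * sqrt (real N) / \<delta> \<le> real (cost A)"
    using t \<delta> by (simp add: field_simps)
qed simp

end
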